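(* Let $\ell\ge2$ be an integer and let $\tau:\mathbb{R}/\mathbb{Z}\to\mathbb{R}$ be a Lipschitz function which is not constant. Then $\mathcal{J}'_\tau$ is finite, counting multiplicities (i.e. $\mathcal{J}'_\tau$ is a finite set and each of its elements has finite multiplicity). Moreover, consider the finite collection $0<\lambda_1,\ldots,\lambda_m\le1$ consisting of the elements of $\mathcal{J}'_\tau$, where the number of repetitions of each element of $\mathcal{J}'_\tau$ coincides with its multiplicity. Then there exists a Lipschitz function $\mu:\mathbb{R}/\mathbb{Z}\to\mathbb{R}$ such that $$\tau=\mathcal{L}_{\lambda_1}\circ\cdots\circ\mathcal{L}_{\lambda_m}\mu$$ and $\mu\ne\mathcal{L}_\lambda\rho$ for all Lipschitz maps $\rho:\mathbb{R}/\mathbb{Z}\to\mathbb{R}$ and all $\lambda\in(0,1]$. Furthermore, if $\int_{\mathbb{R}/\mathbb{Z}}\tau=0$, then $\mu$ may be chosen so that $\int_{\mathbb{R}/\mathbb{Z}}\mu=0$.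
   Context: $\mathbf{m}_\ell:\mathbb{R}/\mathbb{Z}\to\mathbb{R}/\mathbb{Z}$ is $\theta\mapsto\ell\theta$. For $\lambda\in(0,1]$ and $\mu:\mathbb{R}/\mathbb{Z}\to\mathbb{R}$, $\mathcal{L}_\lambda\mu=\mu\circ\mathbf{m}_\ell-\lambda\mu$. Integrals are with respect to Lebesgue measure on $\mathbb{R}/\mathbb{Z}$. Multiplicity: for a continuous $\tau:\mathbb{R}/\mathbb{Z}\to\mathbb{R}$ and $\lambda\in(0,1]$, define $\operatorname{mult}_\tau(\lambda)$ by: $\operatorname{mult}_\tau(\lambda)=0$ if $\mathcal{L}_\lambda\mu\ne\tau$ for all continuous $\mu$; $\operatorname{mult}_\tau(\lambda)=n$ if $\mathcal{L}_\lambda^n\mu=\tau$ for some integer $n>0$ and some continuous $\mu$ such that $\operatorname{mult}_{\mu-\int\mu}(\lambda)=0$; $\operatorname{mult}_\tau(\lambda)=\infty$ otherwise. Put $\mathcal{J}'_\tau=\{\lambda\in(0,1]:\operatorname{mult}_\tau(\lambda)>0\}$; the multiplicity of $\lambda\in\mathcal{J}'_\tau$ is $\operatorname{mult}_\tau(\lambda)$. If $m=0$ the composition is the identity. *)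

theory Defs
  imports "HOL-Analysis.Analysis" "HOL-Library.Periodic_Fun" "HOL-Library.Extended_Nat"
begin

text \<open>
  A function on the circle \<open>\<real>/\<int>\<close> is represented by its lift to the real line, i.e. by a function
  \<open>real \<Rightarrow> real\<close> of period 1.  A function on the circle is continuous iff its lift is.  For the
  quotient metric \<open>d(x, y) = min\<^sub>n \<bar>x - y + n\<bar>\<close> it is Lipschitz iff its lift is, with
  the same constants.
\<close>

definition circle_continuous :: "(real \<Rightarrow> real) \<Rightarrow> bool" where
  "circle_continuous f \<longleftrightarrow> periodic_fun_simple' f \<and> continuous_on UNIV f"

definition circle_lipschitz :: "(real \<Rightarrow> real) \<Rightarrow> bool" where
  "circle_lipschitz f \<longleftrightarrow> periodic_fun_simple' f \<and> (\<exists>C. C-lipschitz_on UNIV f)"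

definition circle_integral :: "(real \<Rightarrow> real) \<Rightarrow> real" where
  "circle_integral f = (LINT x:{0..1}|lborel. f x)"

definition circle_mult :: "nat \<Rightarrow> real \<Rightarrow> real" where
  "circle_mult l \<theta> = real l * \<theta>"

definition Lop :: "nat \<Rightarrow> real \<Rightarrow> (real \<Rightarrow> real) \<Rightarrow> real \<Rightarrow> real" where
  "Lop l lam \<mu> = (\<lambda>\<theta>. (\<mu> \<circ> circle_mult l) \<theta> - lam * \<mu> \<theta>)"

text \<open>
  The definition of the multiplicity refers to itself only through the condition that the
  multiplicity of \<open>\<mu> - \<integral>\<mu>\<close> be 0.  Of its three clauses only the first one yields the value 0, so
  this condition is exactly the predicate \<open>mult_zero\<close>, and no recursion is needed.
\<close>

definition mult_zero :: "nat \<Rightarrow> (real \<Rightarrow> real) \<Rightarrow> real \<Rightarrow> bool" where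
  "mult_zero l \<tau> lam \<longleftrightarrow> (\<forall>\<mu>. circle_continuous \<mu> \<longrightarrow> Lop l lam \<mu> \<noteq> \<tau>)"

definition mult_witness :: "nat \<Rightarrow> (real \<Rightarrow> real) \<Rightarrow> real \<Rightarrow> nat \<Rightarrow> bool" where
  "mult_witness l \<tau> lam n \<longleftrightarrow> n > 0 \<and>
     (\<exists>\<mu>. circle_continuous \<mu> \<and> (Lop l lam ^^ n) \<mu> = \<tau> \<and>
          mult_zero l (\<lambda>\<theta>. \<mu> \<theta> - circle_integral \<mu>) lam)"

text \<open>
  For \<open>l \<ge> 2\<close> and \<open>0 < lam \<le> 1\<close> at most one \<open>n\<close> satisfies \<open>mult_witness\<close>: \<open>Lop l lam\<close> is injective
  on continuous functions modulo constants, and any continuous \<open>Lop l lam \<rho>\<close> minus its mean is again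
  of the form \<open>Lop l lam \<rho>'\<close>.  So the definite description below is legitimate.
\<close>

definition Lmult :: "nat \<Rightarrow> (real \<Rightarrow> real) \<Rightarrow> real \<Rightarrow> enat" where
  "Lmult l \<tau> lam =
     (if mult_zero l \<tau> lam then 0
      else if \<exists>n. mult_witness l \<tau> lam n then enat (THE n. mult_witness l \<tau> lam n)
      else \<infinity>)"

definition J' :: "nat \<Rightarrow> (real \<Rightarrow> real) \<Rightarrow> real set" where
  "J' l \<tau> = {lam \<in> {0<..1}. Lmult l \<tau> lam > 0}"

text \<open>The composition of the operators \<open>Lop l lam\<close>, \<open>lam\<close> ranging over a list; the identity for \<open>[]\<close>.\<close>

definition Lop_comp :: "nat \<Rightarrow> real list \<Rightarrow> (real \<Rightarrow> real) \<Rightarrow> real \<Rightarrow> real" where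
  "Lop_comp l lams = foldr (\<circ>) (map (Lop l) lams) id"

text \<open>\<open>lams\<close> lists the elements of \<open>J' l \<tau>\<close>, in any order, each repeated according to its multiplicity.\<close>

definition enumerates_J' :: "nat \<Rightarrow> (real \<Rightarrow> real) \<Rightarrow> real list \<Rightarrow> bool" where
  "enumerates_J' l \<tau> lams \<longleftrightarrow> set lams = J' l \<tau> \<and>
     (\<forall>lam\<in>J' l \<tau>. enat (count_list lams lam) = Lmult l \<tau> lam)"

definition lipschitz_irreducible :: "nat \<Rightarrow> (real \<Rightarrow> real) \<Rightarrow> bool" where
  "lipschitz_irreducible l \<mu> \<longleftrightarrow>
     (\<forall>\<rho> lam. circle_lipschitz \<rho> \<and> 0 < lam \<and> lam \<le> 1 \<longrightarrow> \<mu> \<noteq> Lop l lam \<rho>)"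

end

theory Submission
  imports Defs
begin

text \<open>
  A continuous solution \<open>\<mu>\<close> of \<open>Lop l lam \<mu> = \<tau>\<close> satisfies
  \<open>\<mu> x = lam * \<mu> (x / l) + \<tau> (x / l)\<close> on lifts; iterating this shows that every Lipschitz constant of
  \<open>\<tau>\<close> is one of \<open>\<mu>\<close>.  Let \<open>P\<close> average a function over the inverse branches of
  multiplication by \<open>l\<close>.  The functional
  \<open>f \<mapsto> \<Sum>n. (P\<^sup>n f (x) - P\<^sup>n f (x + 1/l)) z\<^sup>n\<close> turns \<open>Lop l lam\<close> into multiplication by \<open>z - lam\<close>,
  and for \<open>0 < z < 1\<close> it is bounded by twice the Lipschitz constant.  Hence a factorization of \<open>\<tau>\<close>
  with \<open>m\<close> factors makes its value at \<open>\<tau>\<close> of size \<open>O(max z (1 - z)\<^sup>m)\<close>.  Since \<open>\<tau>\<close> is not constant,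
  this value is nonzero for some \<open>x\<close> and \<open>z\<close>, which bounds \<open>m\<close>.  In a factorization of maximal length,
  each \<open>lam\<close> occurs as often as its multiplicity, and the remaining function is irreducible.
\<close>

section \<open>The operators on continuous functions\<close>

lemma circle_continuous_iff:
  "circle_continuous f \<longleftrightarrow> (\<forall>x. f (x + 1) = f x) \<and> continuous_on UNIV f"
  by (simp add: circle_continuous_def periodic_fun_simple'_def)

lemma circle_continuous_periodic:
  assumes "circle_continuous f"
  shows "f (x + real n) = f x"
proof -
  interpret periodic_fun_simple' f
    using assms by (simp add: circle_continuous_def)
  show ?thesis by (rule plus_of_nat)
qed

lemma circle_lipschitz_imp_continuous: "circle_lipschitz f \<Longrightarrow> circle_continuous f"
  by (auto simp: circle_lipschitz_def circle_continuous_def intro: lipschitz_on_continuous_on)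

lemma circle_continuous_const: "circle_continuous (\<lambda>x. c)"
  by (simp add: circle_continuous_iff)

lemma circle_continuous_linear:
  assumes "circle_continuous f" "circle_continuous g"
  shows "circle_continuous (\<lambda>x. a * f x + b * g x)"
  using assms unfolding circle_continuous_iff by (auto intro!: continuous_intros)

lemma circle_continuous_add_const:
  "circle_continuous f \<Longrightarrow> circle_continuous (\<lambda>x. f x + c)"
  using circle_continuous_linear[OF _ circle_continuous_const, of f 1 1 c] by simp

lemma Lop_apply: "Lop l lam f x = f (real l * x) - lam * f x"
  by (simp add: Lop_def circle_mult_def)

lemma circle_continuous_comp_mult:
  assumes "circle_continuous f"
  shows "circle_continuous (\<lambda>x. f (real l * x))"
proof -
  have "f (real l * (x + 1)) = f (real l * x)" for x
    using circle_continuous_periodic[OF assms, of "real l * x" l] by (simp add: algebra_simps)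
  moreover have "continuous_on UNIV (\<lambda>x. f (real l * x))"
    using assms by (auto simp: circle_continuous_iff intro!: continuous_on_compose2[of UNIV f]
        continuous_intros)
  ultimately show ?thesis
    by (simp add: circle_continuous_iff)
qed

lemma circle_continuous_Lop: "circle_continuous f \<Longrightarrow> circle_continuous (Lop l lam f)"
  using circle_continuous_linear[OF circle_continuous_comp_mult, of f f 1 l "- lam"]
  by (simp add: Lop_apply[abs_def])

lemma circle_continuous_Lop_funpow:
  "circle_continuous f \<Longrightarrow> circle_continuous ((Lop l lam ^^ n) f)"
  by (induction n) (auto intro: circle_continuous_Lop)

lemma Lop_linear: "Lop l lam (\<lambda>x. a * f x + b * g x) = (\<lambda>x. a * Lop l lam f x + b * Lop l lam g x)"
  by (auto simp: Lop_apply algebra_simps)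

text \<open>Constants are eigenfunctions with eigenvalue \<open>1 - lam\<close>; for
  \<open>lam = 1\<close> they are annihilated, hence the special role of 1 below.\<close>

lemma Lop_add_const: "Lop l lam (\<lambda>x. f x + c) = (\<lambda>x. Lop l lam f x + (1 - lam) * c)"
  by (auto simp: Lop_apply algebra_simps)

lemma Lop_commute: "Lop l a (Lop l b f) = Lop l b (Lop l a f)"
  by (auto simp: Lop_apply algebra_simps)

lemma Lop_comp_Nil [simp]: "Lop_comp l [] f = f"
  and Lop_comp_Cons [simp]: "Lop_comp l (lam # ls) f = Lop l lam (Lop_comp l ls f)"
  by (simp_all add: Lop_comp_def)

lemma Lop_comp_commute: "Lop_comp l ls (Lop l lam f) = Lop l lam (Lop_comp l ls f)"
  by (induction ls) (simp_all add: Lop_commute)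

text \<open>The factors commute. An enumeration of \<open>J'\<close> is determined only up to
  order.\<close>

lemma Lop_comp_mset_cong:
  assumes "mset ls = mset ls'"
  shows "Lop_comp l ls = Lop_comp l ls'"
proof -
  have "fold (Lop l) (rev ls) f = fold (Lop l) (rev ls') f" for f
    by (rule fold_permuted_eq[where P = "\<lambda>_. True"]) (auto simp: assms intro: Lop_commute)
  moreover have "Lop_comp l ls f = fold (Lop l) (rev ls) f" for ls f
    by (induction ls) simp_all
  ultimately show ?thesis
    by auto
qed

text \<open>Brings a factorization into the form in which the multiplicity of \<open>lam\<close> is
  defined.\<close>

lemma Lop_comp_split:
  "Lop_comp l ls f = (Lop l lam ^^ count_list ls lam) (Lop_comp l (filter (\<lambda>x. x \<noteq> lam) ls) f)"
proof (induction ls)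
  case (Cons a ls)
  have "Lop l a ((Lop l lam ^^ n) g) = (Lop l lam ^^ n) (Lop l a g)" for n g
    by (induction n) (simp_all add: Lop_commute[of l a lam])
  with Cons show ?case
    by auto
qed simp

lemma circle_continuous_Lop_comp:
  "circle_continuous f \<Longrightarrow> circle_continuous (Lop_comp l ls f)"
  by (induction ls) (auto intro: circle_continuous_Lop)

lemma Lop_comp_add_const:
  "Lop_comp l ls (\<lambda>x. f x + c) = (\<lambda>x. Lop_comp l ls f x + (\<Prod>a\<leftarrow>ls. 1 - a) * c)"
  by (induction ls) (simp_all add: Lop_add_const mult.assoc)

lemma prod_list_eq_0_if_mem: "x \<in> set xs \<Longrightarrow> f x = 0 \<Longrightarrow> (\<Prod>a\<leftarrow>xs. f a) = (0::real)"
  by (force simp: prod_list_zero_iff)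

section \<open>Lipschitz regularity and uniqueness of preimages\<close>

lemma lipschitz_on_Lop_preimage:
  assumes l: "l \<ge> 2" and lam: "0 < lam" "lam \<le> 1" and \<mu>: "circle_continuous \<mu>"
    and lip: "K-lipschitz_on UNIV (Lop l lam \<mu>)"
  shows "K-lipschitz_on UNIV \<mu>"
proof (rule lipschitz_onI)
  show "0 \<le> K"
    using lip by (rule lipschitz_on_nonneg)
  fix x y :: real
  have step: "\<bar>\<mu> x - \<mu> y\<bar> \<le> \<bar>\<mu> (x / l) - \<mu> (y / l)\<bar> + K * \<bar>x - y\<bar> / 2" for x y
  proof -
    define t where "t = Lop l lam \<mu>"
    have eq: "\<mu> z = lam * \<mu> (z / l) + t (z / l)" for z
      using l by (simp add: t_def Lop_apply)
    have "\<bar>t (x / l) - t (y / l)\<bar> \<le> K * \<bar>x / l - y / l\<bar>"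
      using lipschitz_onD[OF lip, of "x / l" "y / l"] by (simp add: dist_real_def t_def)
    also have "\<bar>x / l - y / l\<bar> = \<bar>x - y\<bar> / l"
      by (simp add: diff_divide_distrib [symmetric])
    also have "K * (\<bar>x - y\<bar> / l) \<le> K * (\<bar>x - y\<bar> / 2)"
      using l \<open>0 \<le> K\<close> by (intro mult_left_mono divide_left_mono) auto
    finally have 1: "\<bar>t (x / l) - t (y / l)\<bar> \<le> K * \<bar>x - y\<bar> / 2"
      by simp
    have "\<mu> x - \<mu> y = lam * (\<mu> (x / l) - \<mu> (y / l)) + (t (x / l) - t (y / l))"
      unfolding eq[of x] eq[of y] by (simp add: algebra_simps)
    then have "\<bar>\<mu> x - \<mu> y\<bar> \<le> lam * \<bar>\<mu> (x / l) - \<mu> (y / l)\<bar> + \<bar>t (x / l) - t (y / l)\<bar>"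
      using lam abs_triangle_ineq[of "lam * (\<mu> (x / l) - \<mu> (y / l))" "t (x / l) - t (y / l)"]
      by (simp add: abs_mult)
    moreover have "lam * \<bar>\<mu> (x / l) - \<mu> (y / l)\<bar> \<le> 1 * \<bar>\<mu> (x / l) - \<mu> (y / l)\<bar>"
      using lam by (intro mult_right_mono) auto
    ultimately show ?thesis
      using 1 by linarith
  qed
  have bound: "\<bar>\<mu> x - \<mu> y\<bar> \<le> \<bar>\<mu> (x / l ^ n) - \<mu> (y / l ^ n)\<bar> + K * \<bar>x - y\<bar>" for n
  proof -
    \<comment> \<open>\<open>1 - 1 / 2 ^ n\<close> is the sum \<open>1/2 + 1/4 + ...\<close> of the
      first \<open>n\<close> increments, so the constant \<open>K\<close> never gets worse.\<close>
    have "\<bar>\<mu> x - \<mu> y\<bar> \<le> \<bar>\<mu> (x / l ^ n) - \<mu> (y / l ^ n)\<bar> + K * \<bar>x - y\<bar> * (1 - 1 / 2 ^ n)"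
    proof (induction n)
      case (Suc n)
      have "2 ^ n \<le> real l ^ n"
        using l by (intro power_mono) auto
      have "\<bar>\<mu> (x / l ^ n) - \<mu> (y / l ^ n)\<bar> \<le>
          \<bar>\<mu> (x / l ^ Suc n) - \<mu> (y / l ^ Suc n)\<bar> + K * \<bar>x / l ^ n - y / l ^ n\<bar> / 2"
        using step[of "x / l ^ n" "y / l ^ n"] by (simp add: field_simps)
      also have "\<bar>x / l ^ n - y / l ^ n\<bar> = \<bar>x - y\<bar> / l ^ n"
        by (simp add: diff_divide_distrib [symmetric])
      also have "K * (\<bar>x - y\<bar> / l ^ n) / 2 \<le> K * (\<bar>x - y\<bar> / 2 ^ n) / 2"
        using l \<open>0 \<le> K\<close> \<open>2 ^ n \<le> real l ^ n\<close>
        by (intro mult_left_mono divide_left_mono divide_right_mono) auto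
      finally show ?case
        using Suc by (simp add: field_simps)
    qed simp
    also have "K * \<bar>x - y\<bar> * (1 - 1 / 2 ^ n) \<le> K * \<bar>x - y\<bar> * 1"
      using \<open>0 \<le> K\<close> by (intro mult_left_mono) auto
    finally show ?thesis by simp
  qed
  \<comment> \<open>On the real line \<open>x / l ^ n\<close> and \<open>y / l ^ n\<close> both tend
    to 0, so continuity at 0 removes the remainder.\<close>
  have cont: "isCont \<mu> 0"
    using \<mu> by (simp add: circle_continuous_iff continuous_on_eq_continuous_at)
  have lim_at_0: "(\<lambda>n. \<mu> (z / l ^ n)) \<longlonglongrightarrow> \<mu> 0" for z
  proof (rule isCont_tendsto_compose[OF cont])
    show "(\<lambda>n. z / l ^ n) \<longlonglongrightarrow> 0"
      using l LIMSEQ_divide_realpow_zero[of "real l" z] by simp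
  qed
  have lim: "(\<lambda>n. \<bar>\<mu> (x / l ^ n) - \<mu> (y / l ^ n)\<bar> + K * \<bar>x - y\<bar>)
      \<longlonglongrightarrow> \<bar>\<mu> 0 - \<mu> 0\<bar> + K * \<bar>x - y\<bar>"
    by (intro tendsto_add tendsto_rabs tendsto_diff tendsto_const lim_at_0)
  show "dist (\<mu> x) (\<mu> y) \<le> K * dist x y"
    using LIMSEQ_le_const[OF lim] bound by (auto simp: dist_real_def)
qed

lemma Lop_preimage_const:
  assumes "l \<ge> 2" "0 < lam" "lam \<le> 1" "circle_continuous \<mu>" "Lop l lam \<mu> = (\<lambda>x. c)"
  shows "\<exists>d. \<mu> = (\<lambda>x. d)"
proof -
  have "0-lipschitz_on UNIV (Lop l lam \<mu>)"
    by (simp add: assms(5) lipschitz_on_def)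
  then have "0-lipschitz_on UNIV \<mu>"
    by (rule lipschitz_on_Lop_preimage[OF assms(1-4)])
  then have "\<mu> = (\<lambda>x. \<mu> 0)"
    by (auto simp: lipschitz_on_def)
  then show ?thesis by blast
qed

lemma Lop_funpow_eq_imp_diff_const:
  assumes "l \<ge> 2" "0 < lam" "lam \<le> 1" "circle_continuous f" "circle_continuous g"
    and "(Lop l lam ^^ n) f = (Lop l lam ^^ n) g"
  shows "\<exists>d. f = (\<lambda>x. g x + d)"
proof -
  define h where "h = (\<lambda>x. 1 * f x + (-1) * g x)"
  have "circle_continuous h"
    unfolding h_def by (intro circle_continuous_linear assms)
  have "(Lop l lam ^^ n) h = (\<lambda>x. 1 * (Lop l lam ^^ n) f x + (-1) * (Lop l lam ^^ n) g x)"
    unfolding h_def by (induction n) (simp_all only: Lop_linear funpow.simps o_apply id_apply)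
  then have "(Lop l lam ^^ n) h = (\<lambda>x. 0)"
    by (simp add: assms(6))
  \<comment> \<open>Weakened from 0 to some constant, because each step of the induction returns
    only a constant.\<close>
  then have "\<exists>d. (Lop l lam ^^ n) h = (\<lambda>x. d)"
    by blast
  then have "\<exists>d. h = (\<lambda>x. d)"
  proof (induction n)
    case (Suc n)
    then show ?case
      using Lop_preimage_const[OF assms(1-3), of "(Lop l lam ^^ n) h"]
        circle_continuous_Lop_funpow[OF \<open>circle_continuous h\<close>] by auto
  qed simp
  then obtain d where "h = (\<lambda>x. d)" by blast
  then have "h x = d" for x
    by simp
  then have "f x = g x + d" for x
    unfolding h_def by (simp add: algebra_simps)
  then show ?thesis
    by blast
qed

section \<open>Means\<close>

lemma circle_integral_has_integral:
  assumes "circle_continuous f"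
  shows "(f has_integral circle_integral f) {0..1}"
proof -
  have c: "continuous_on {0..1} f"
    using assms by (auto simp: circle_continuous_iff intro: continuous_on_subset)
  then have "set_integrable lborel {0..1} f"
    by (rule borel_integrable_atLeastAtMost')
  from set_borel_integral_eq_integral[OF this] show ?thesis
    by (auto simp: circle_integral_def has_integral_iff)
qed

lemma circle_integral_eqI:
  assumes "circle_continuous f" "(f has_integral I) {0..1}"
  shows "circle_integral f = I"
  using has_integral_unique circle_integral_has_integral assms by blast

lemma circle_integral_add_const:
  assumes "circle_continuous f"
  shows "circle_integral (\<lambda>x. f x + c) = circle_integral f + c"
  using has_integral_add[OF circle_integral_has_integral[OF assms] has_integral_const_real[of c 0 1]]
  by (intro circle_integral_eqI circle_continuous_add_const assms) simp

text \<open>Rescaling maps \<open>{0..1}\<close> onto \<open>{0..real l}\<close>, which consists of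
  \<open>l\<close> periods with the same integral.\<close>

lemma circle_integral_comp_mult:
  assumes "circle_continuous f" and l: "l > 0"
  shows "circle_integral (\<lambda>x. f (real l * x)) = circle_integral f"
proof (rule circle_integral_eqI)
  let ?I = "circle_integral f"
  have shift: "(f has_integral ?I) {real n..real n + 1}" for n
  proof -
    have "(f \<circ> (+) (real n)) = f"
      using circle_continuous_periodic[OF assms(1)] by (auto simp: add.commute)
    then have "((f \<circ> (+) (real n)) has_integral ?I) (cbox 0 1)"
      using circle_integral_has_integral[OF assms(1)] by simp
    then show ?thesis
      by (subst (asm) has_integral_shift_cbox_iff) (simp add: add.commute)
  qed
  have "(f has_integral (real n * ?I)) {0..real n}" for n
  proof (induction n)
    case (Suc n)
    show ?case
      using has_integral_combine[OF _ _ Suc shift[of n]] by (simp add: algebra_simps)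
  qed (simp add: has_integral_refl)
  from has_integral_stretch_real[OF this[of l], of "real l"]
  show "((\<lambda>x. f (real l * x)) has_integral ?I) {0..1}"
    using l by simp
  show "circle_continuous (\<lambda>x. f (real l * x))"
    by (intro circle_continuous_comp_mult assms)
qed

lemma circle_integral_Lop:
  assumes "circle_continuous f" and l: "l > 0"
  shows "circle_integral (Lop l lam f) = (1 - lam) * circle_integral f"
proof (rule circle_integral_eqI)
  have "((\<lambda>x. f (real l * x)) has_integral circle_integral f) {0..1}"
    using circle_integral_has_integral[OF circle_continuous_comp_mult[OF assms(1)], of l]
    by (simp add: circle_integral_comp_mult[OF assms])
  from has_integral_diff[OF this
      has_integral_mult_right[OF circle_integral_has_integral[OF assms(1)], of lam]]
  show "(Lop l lam f has_integral (1 - lam) * circle_integral f) {0..1}"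
    by (simp add: Lop_apply[abs_def] algebra_simps)
qed (intro circle_continuous_Lop assms)

lemma circle_integral_Lop_comp:
  assumes "circle_continuous f" and l: "l > 0"
  shows "circle_integral (Lop_comp l ls f) = (\<Prod>a\<leftarrow>ls. 1 - a) * circle_integral f"
  by (induction ls)
    (simp_all add: circle_integral_Lop circle_continuous_Lop_comp assms)

section \<open>The transfer operator\<close>

text \<open>The normalized Perron-Frobenius operator of multiplication by \<open>l\<close>.\<close>

definition transfer :: "nat \<Rightarrow> (real \<Rightarrow> real) \<Rightarrow> real \<Rightarrow> real" where
  "transfer l f = (\<lambda>x. (\<Sum>j<l. f ((x + real j) / real l)) / real l)"

lemma transfer_linear:
  "transfer l (\<lambda>x. a * f x + b * g x) = (\<lambda>x. a * transfer l f x + b * transfer l g x)"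
  by (auto simp: transfer_def sum.distrib sum_distrib_left add_divide_distrib)

lemma transfer_funpow_linear:
  "(transfer l ^^ n) (\<lambda>x. a * f x + b * g x) =
    (\<lambda>x. a * (transfer l ^^ n) f x + b * (transfer l ^^ n) g x)"
  by (induction n) (simp_all only: transfer_linear funpow.simps o_apply id_apply)

text \<open>On periodic functions \<open>transfer l\<close> is a left inverse of composition with
  multiplication by \<open>l\<close>: all summands \<open>f (x + j)\<close> equal
  \<open>f x\<close>.\<close>

lemma transfer_Lop:
  assumes "l > 0" "circle_continuous f"
  shows "transfer l (Lop l lam f) = (\<lambda>x. 1 * f x + (- lam) * transfer l f x)"
proof
  fix x
  show "transfer l (Lop l lam f) x = 1 * f x + (- lam) * transfer l f x"
    using assms circle_continuous_periodic[OF assms(2)]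
    by (simp add: transfer_def Lop_apply sum_subtractf diff_divide_distrib flip: sum_distrib_left)
qed

lemma transfer_lipschitz:
  assumes "l > 0" "K-lipschitz_on UNIV f"
  shows "(K / l)-lipschitz_on UNIV (transfer l f)"
proof (rule lipschitz_onI)
  show "0 \<le> K / l"
    using lipschitz_on_nonneg[OF assms(2)] by simp
  fix x y :: real
  have "\<bar>\<Sum>j<l. f ((x + real j) / l) - f ((y + real j) / l)\<bar> \<le> (\<Sum>j<l. K * (\<bar>x - y\<bar> / l))"
  proof (intro order.trans[OF sum_abs] sum_mono)
    fix j
    have "(x + real j) / l - (y + real j) / l = (x - y) / l"
      by (simp add: diff_divide_distrib [symmetric])
    then show "\<bar>f ((x + real j) / l) - f ((y + real j) / l)\<bar> \<le> K * (\<bar>x - y\<bar> / l)"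
      using lipschitz_onD[OF assms(2), of "(x + real j) / l" "(y + real j) / l"]
      by (simp add: dist_real_def)
  qed
  then show "dist (transfer l f x) (transfer l f y) \<le> K / l * dist x y"
    using assms(1)
    by (simp add: transfer_def dist_real_def sum_subtractf field_simps
        flip: diff_divide_distrib)
qed

lemma transfer_funpow_lipschitz:
  assumes "l > 0" "K-lipschitz_on UNIV f"
  shows "(K / l ^ n)-lipschitz_on UNIV ((transfer l ^^ n) f)"
proof (induction n)
  case (Suc n)
  then show ?case
    using transfer_lipschitz[OF assms(1) Suc] by (simp add: mult.commute)
qed (use assms in simp)

lemma transfer_of_periodic:
  assumes "l > 0" and per: "\<And>x. f (x + 1 / l) = f x"
  shows "transfer l f (real l * x) = f x"
proof -
  have "f (x + real j / l) = f x" for j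
  proof (induction j)
    case (Suc j)
    then show ?case
      using per[of "x + real j / l"] by (simp add: add_divide_distrib add_ac)
  qed simp
  moreover have "(l * x + real j) / l = x + real j / l" for j
    using assms(1) by (simp add: field_simps)
  ultimately show ?thesis
    using assms(1) by (simp add: transfer_def)
qed

section \<open>Jumps of the iterates between two points with the same image on the circle\<close>

definition jump :: "nat \<Rightarrow> real \<Rightarrow> (real \<Rightarrow> real) \<Rightarrow> nat \<Rightarrow> real" where
  "jump l x f n = (transfer l ^^ n) f x - (transfer l ^^ n) f (x + 1 / real l)"

text \<open>The values \<open>f (l * x)\<close> and \<open>f (l * x + 1)\<close> cancel by
  periodicity.\<close>

lemma jump_0_Lop:
  assumes "l > 0" "circle_continuous f"
  shows "jump l x (Lop l lam f) 0 = - lam * jump l x f 0"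
  using assms circle_continuous_periodic[OF assms(2), of "real l * x" 1]
  by (simp add: jump_def Lop_apply algebra_simps)

text \<open>Together with the case 0 this is the coefficient recursion for multiplication by
  \<open>z - lam\<close>.\<close>

lemma jump_Suc_Lop:
  assumes "l > 0" "circle_continuous f"
  shows "jump l x (Lop l lam f) (Suc n) = jump l x f n - lam * jump l x f (Suc n)"
  unfolding jump_def funpow_Suc_right o_apply transfer_Lop[OF assms] transfer_funpow_linear
  by (simp add: algebra_simps)

lemma abs_jump_le:
  assumes "l \<ge> 2" "K-lipschitz_on UNIV f"
  shows "\<bar>jump l x f n\<bar> \<le> K / 2 ^ n"
proof -
  have "K \<ge> 0"
    using assms(2) by (rule lipschitz_on_nonneg)
  have "2 ^ n \<le> real l ^ n"
    using assms by (intro power_mono) auto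
  have "\<bar>jump l x f n\<bar> \<le> K / l ^ n * (1 / l)"
    using lipschitz_onD[OF transfer_funpow_lipschitz[OF _ assms(2), of l n], of x "x + 1 / l"] assms(1)
    by (simp add: jump_def dist_real_def)
  also have "\<dots> \<le> K / 2 ^ n * 1"
    using assms(1) \<open>K \<ge> 0\<close> \<open>2 ^ n \<le> real l ^ n\<close>
    by (intro mult_mono divide_left_mono) auto
  finally show ?thesis by simp
qed

text \<open>Without jumps each iterate has period \<open>1 / l\<close>, so \<open>f x\<close> is the
  value of the \<open>n\<close>-th iterate at \<open>l ^ n * x\<close>. That iterate oscillates by
  at most a multiple of \<open>K / l ^ n\<close>, which tends to 0.\<close>

lemma constant_if_jumps_vanish:
  assumes l: "l \<ge> 2" and lip: "K-lipschitz_on UNIV f" and jump: "\<And>x n. jump l x f n = 0"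
  shows "f constant_on UNIV"
proof -
  define h where "h n = (transfer l ^^ n) f" for n
  have per: "h n (x + 1 / l) = h n x" for n x
    using jump[of x n] by (simp add: jump_def h_def)
  have f_eq: "f x = h n (real l ^ n * x)" for n x
  proof (induction n)
    case (Suc n)
    have "h (Suc n) (real l * (real l ^ n * x)) = h n (real l ^ n * x)"
      using transfer_of_periodic[of l "h n", OF _ per] l by (simp add: h_def)
    with Suc show ?case
      by (simp add: mult.assoc)
  qed (simp add: h_def)
  have per1: "h n (x + 1) = h n x" for n x
  proof -
    have "h n (x + real j / l) = h n x" for j
    proof (induction j)
      case (Suc j)
      then show ?case
        using per[of n "x + real j / l"] by (simp add: add_divide_distrib add_ac)
    qed simp
    from this[of l] show ?thesis
      using l by simp
  qed
  \<comment> \<open>Reduction to the fractional part makes the bound uniform in \<open>x\<close>; it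
    is applied at the large argument \<open>l ^ n * x\<close>.\<close>
  have osc: "\<bar>h n x - h n 0\<bar> \<le> K / l ^ n" for n x
  proof -
    interpret periodic_fun_simple' "h n"
      by standard (rule per1)
    have "h n x = h n (frac x)"
      using minus_of_int[of x "\<lfloor>x\<rfloor>"] by (simp add: frac_def)
    moreover have "\<bar>h n (frac x) - h n 0\<bar> \<le> K / l ^ n * frac x"
      using lipschitz_onD[OF transfer_funpow_lipschitz[OF _ lip, of l n], of "frac x" 0] l
      by (simp add: h_def dist_real_def)
    moreover have "K / l ^ n * frac x \<le> K / l ^ n * 1"
      using lipschitz_on_nonneg[OF lip] frac_lt_1[of x] by (intro mult_left_mono) auto
    ultimately show ?thesis by simp
  qed
  have "f x = f 0" for x
  proof -
    have "\<bar>f x - f 0\<bar> \<le> K / real l ^ n" for n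
      using osc[of n "real l ^ n * x"] f_eq[of x n] f_eq[of 0 n] by simp
    moreover have "(\<lambda>n. K / real l ^ n) \<longlonglongrightarrow> 0"
      using l by (intro LIMSEQ_divide_realpow_zero) auto
    ultimately have "\<bar>f x - f 0\<bar> \<le> 0"
      using LIMSEQ_le_const by blast
    then show ?thesis by simp
  qed
  then show ?thesis
    by (auto simp: constant_on_def)
qed

section \<open>The generating function of the jumps\<close>

definition jump_series :: "nat \<Rightarrow> real \<Rightarrow> (real \<Rightarrow> real) \<Rightarrow> real \<Rightarrow> real" where
  "jump_series l x f z = (\<Sum>n. jump l x f n * z ^ n)"

lemma abs_jump_term_le:
  assumes "l \<ge> 2" "K-lipschitz_on UNIV f" "\<bar>z\<bar> \<le> 1"
  shows "norm (jump l x f n * z ^ n) \<le> K * (1 / 2) ^ n"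
proof -
  have "\<bar>jump l x f n\<bar> * \<bar>z\<bar> ^ n \<le> K / 2 ^ n * 1"
    using assms lipschitz_on_nonneg[OF assms(2)]
    by (intro mult_mono abs_jump_le power_le_one) auto
  then show ?thesis
    by (simp add: abs_mult power_abs power_divide)
qed

lemma geometric_half_sums: "(\<lambda>n. K * (1 / 2) ^ n) sums (2 * K :: real)"
  using sums_mult[OF geometric_sums[of "1 / 2 :: real"], of K] by (simp add: mult.commute)

lemma jump_series_sums:
  assumes "l \<ge> 2" "K-lipschitz_on UNIV f" "\<bar>z\<bar> \<le> 1"
  shows "(\<lambda>n. jump l x f n * z ^ n) sums jump_series l x f z"
  unfolding jump_series_def
  using summable_comparison_test'[OF sums_summable[OF geometric_half_sums] abs_jump_term_le[OF assms]]
  by (rule summable_sums)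

lemma abs_jump_series_le:
  assumes "l \<ge> 2" "K-lipschitz_on UNIV f" "\<bar>z\<bar> \<le> 1"
  shows "\<bar>jump_series l x f z\<bar> \<le> 2 * K"
  using norm_sums_le[OF jump_series_sums[OF assms] geometric_half_sums abs_jump_term_le[OF assms]]
  by simp

lemma jump_series_Lop:
  assumes l: "l \<ge> 2" and f: "circle_continuous f" and lip: "K-lipschitz_on UNIV f"
    and z: "\<bar>z\<bar> \<le> 1"
  shows "jump_series l x (Lop l lam f) z = (z - lam) * jump_series l x f z"
proof -
  let ?c = "\<lambda>n. jump l x f n * z ^ n" and ?S = "jump_series l x f z"
  \<comment> \<open>The terms of \<open>z * ?S\<close>, shifted by one index to align the powers of
    \<open>z\<close>.\<close>
  define d where "d n = (case n of 0 \<Rightarrow> 0 | Suc m \<Rightarrow> z * ?c m)" for n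
  have S: "?c sums ?S"
    by (rule jump_series_sums[OF l lip z])
  have "(\<lambda>n. d (Suc n)) sums (z * ?S)"
    unfolding d_def using sums_mult[OF S, of z] by simp
  then have "d sums (z * ?S)"
    by (subst (asm) sums_Suc_iff) (simp add: d_def)
  from sums_diff[OF this sums_mult[OF S, of lam]]
  have "(\<lambda>n. d n - lam * ?c n) sums ((z - lam) * ?S)"
    by (simp add: algebra_simps)
  moreover have "d n - lam * ?c n = jump l x (Lop l lam f) n * z ^ n" for n
    using l f by (cases n) (simp_all add: d_def jump_0_Lop jump_Suc_Lop algebra_simps)
  ultimately show ?thesis
    by (simp add: jump_series_def sums_iff)
qed

text \<open>Once all lower coefficients vanish, \<open>a N\<close> is the limit at 0 of the series
  divided by \<open>z ^ N\<close>. The zeros are given for positive \<open>z\<close>, so the limit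
  is taken from the right.\<close>

lemma powser_coeffs_eq_0:
  fixes a :: "nat \<Rightarrow> real"
  assumes r: "r > 0" and summ: "\<And>z. \<bar>z\<bar> < r \<Longrightarrow> summable (\<lambda>n. a n * z ^ n)"
    and zero: "\<And>z. 0 < z \<Longrightarrow> z < r \<Longrightarrow> (\<Sum>n. a n * z ^ n) = 0"
  shows "a N = 0"
proof (induction N rule: less_induct)
  case (less N)
  define g where "g z = (\<Sum>n. a (n + N) * z ^ n)" for z
  have tail: "summable (\<lambda>n. a (n + N) * z ^ n) \<and> z ^ N * g z = (\<Sum>n. a n * z ^ n)"
    if "z \<noteq> 0" "\<bar>z\<bar> < r" for z
  proof -
    have "(\<lambda>n. a (n + N) * z ^ (n + N)) sums (\<Sum>n. a n * z ^ n)"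
      using summ[OF that(2)] less by (subst sums_iff_shift) (simp add: summable_sums)
    then have sums: "(\<lambda>n. z ^ N * (a (n + N) * z ^ n)) sums (\<Sum>n. a n * z ^ n)"
      by (simp add: power_add mult_ac)
    then have summ': "summable (\<lambda>n. a (n + N) * z ^ n)"
      using sums_summable[OF sums] that(1) by (simp add: summable_cmult_iff)
    have "z ^ N * g z = (\<Sum>n. z ^ N * (a (n + N) * z ^ n))"
      unfolding g_def by (rule suminf_mult[OF summ', symmetric])
    also have "\<dots> = (\<Sum>n. a n * z ^ n)"
      by (rule sums_unique[OF sums, symmetric])
    finally show ?thesis
      using summ' by blast
  qed
  have "(g \<longlongrightarrow> a (0 + N)) (at 0)"
    unfolding g_def
    by (rule powser_limit_0_strong[OF r], rule summable_sums) (simp add: tail)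
  then have "(g \<longlongrightarrow> a N) (at_right 0)"
    by (simp add: filterlim_at_split)
  moreover have "eventually (\<lambda>z. g z = 0) (at_right 0)"
    using eventually_at_right_real[OF r]
  proof eventually_elim
    case (elim z)
    then have "z ^ N * g z = 0"
      using tail[of z] zero[of z] by simp
    with elim show "g z = 0"
      by simp
  qed
  then have "(g \<longlongrightarrow> 0) (at_right 0)"
    by (rule tendsto_eventually)
  ultimately show ?case
    using tendsto_unique[of "at_right (0::real)" g] by auto
qed

text \<open>Otherwise all jumps would vanish. The range \<open>0 < z < 1\<close> later makes the
  factors \<open>z - a\<close> uniformly smaller than 1.\<close>

lemma exists_jump_series_nonzero:
  assumes l: "l \<ge> 2" and lip: "K-lipschitz_on UNIV f" and nonconst: "\<not> f constant_on UNIV"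
  obtains x z where "0 < z" "z < 1" "jump_series l x f z \<noteq> 0"
proof (rule ccontr)
  assume "\<not> thesis"
  with that have zero: "jump_series l x f z = 0" if "0 < z" "z < 1" for x z
    using \<open>0 < z\<close> \<open>z < 1\<close> by blast
  have "jump l x f n = 0" for x n
  proof (rule powser_coeffs_eq_0[of 1])
    show "summable (\<lambda>n. jump l x f n * z ^ n)" if "\<bar>z\<bar> < 1" for z
      using jump_series_sums[OF l lip] that by (auto simp: sums_iff)
  qed (use zero in \<open>auto simp: jump_series_def\<close>)
  with constant_if_jumps_vanish[OF l lip] nonconst show False by blast
qed

section \<open>Factorizations have bounded length\<close>

lemma lipschitz_on_Lop_comp_preimage:
  assumes "l \<ge> 2" "set ls \<subseteq> {0<..1}" "circle_continuous \<mu>"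
    and "K-lipschitz_on UNIV (Lop_comp l ls \<mu>)"
  shows "K-lipschitz_on UNIV \<mu>"
  using assms(2,4)
proof (induction ls)
  case (Cons a ls)
  then show ?case
    using lipschitz_on_Lop_preimage[OF assms(1) _ _ circle_continuous_Lop_comp[OF assms(3)]]
    by auto
qed simp

text \<open>The Lipschitz bound passes to each partial composition, so all intermediate series
  converge and factors can be stripped one by one.\<close>

lemma jump_series_Lop_comp:
  assumes l: "l \<ge> 2" and \<mu>: "circle_continuous \<mu>" and lip: "K-lipschitz_on UNIV (Lop_comp l ls \<mu>)"
    and ls: "set ls \<subseteq> {0<..1}" and z: "\<bar>z\<bar> \<le> 1"
  shows "jump_series l x (Lop_comp l ls \<mu>) z = (\<Prod>a\<leftarrow>ls. z - a) * jump_series l x \<mu> z"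
  using ls lip
proof (induction ls)
  case (Cons a ls)
  have c: "circle_continuous (Lop_comp l ls \<mu>)"
    by (intro circle_continuous_Lop_comp \<mu>)
  have "K-lipschitz_on UNIV (Lop_comp l ls \<mu>)"
    using Cons.prems by (intro lipschitz_on_Lop_preimage[OF l _ _ c, of a]) auto
  then show ?case
    using Cons jump_series_Lop[OF l c _ z] by simp
qed simp

lemma length_factorization_bounded:
  assumes l: "l \<ge> 2" and \<tau>: "circle_lipschitz \<tau>" "\<not> \<tau> constant_on UNIV"
  obtains M where "\<And>ls \<mu>. set ls \<subseteq> {0<..1} \<Longrightarrow> circle_continuous \<mu> \<Longrightarrow> \<tau> = Lop_comp l ls \<mu> \<Longrightarrow>
    length ls < M"
proof -
  obtain K where K: "K-lipschitz_on UNIV \<tau>"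
    using \<tau> by (auto simp: circle_lipschitz_def)
  obtain x z where z: "0 < z" "z < 1" and nz: "jump_series l x \<tau> z \<noteq> 0"
    by (rule exists_jump_series_nonzero[OF l K \<tau>(2)])
  \<comment> \<open>For \<open>0 < a \<le> 1\<close> the difference \<open>z - a\<close> lies
    between \<open>z - 1\<close> and \<open>z\<close>, so \<open>r\<close> bounds its absolute
    value.\<close>
  define r where "r = max z (1 - z)"
  have r: "0 < r" "r < 1"
    using z by (auto simp: r_def)
  have "(\<lambda>n. r ^ n * (2 * K)) \<longlonglongrightarrow> 0 * (2 * K)"
    using r by (intro tendsto_intros LIMSEQ_power_zero) auto
  then have "eventually (\<lambda>n. r ^ n * (2 * K) < \<bar>jump_series l x \<tau> z\<bar>) sequentially"
    using nz by (intro order_tendstoD) auto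
  then obtain M where M: "\<And>n. n \<ge> M \<Longrightarrow> r ^ n * (2 * K) < \<bar>jump_series l x \<tau> z\<bar>"
    by (auto simp: eventually_sequentially)
  show thesis
  proof (rule that)
    fix ls \<mu>
    assume ls: "set ls \<subseteq> {0<..1}" and \<mu>: "circle_continuous \<mu>" and eq: "\<tau> = Lop_comp l ls \<mu>"
    \<comment> \<open>The same \<open>K\<close> serves for factorizations of every length, so the
      bound \<open>2 * K\<close> below is uniform.\<close>
    have lip: "K-lipschitz_on UNIV \<mu>"
      using lipschitz_on_Lop_comp_preimage[OF l ls \<mu>] K eq by simp
    have prod: "\<bar>\<Prod>a\<leftarrow>ls. z - a\<bar> \<le> r ^ length ls"
      using ls
    proof (induction ls)
      case (Cons a ls)
      have "\<bar>z - a\<bar> \<le> r"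
        using Cons.prems z by (auto simp: r_def)
      with Cons r show ?case
        by (auto simp: abs_mult intro!: mult_mono)
    qed simp
    have "\<bar>jump_series l x \<tau> z\<bar> = \<bar>\<Prod>a\<leftarrow>ls. z - a\<bar> * \<bar>jump_series l x \<mu> z\<bar>"
      using jump_series_Lop_comp[OF l \<mu> _ ls] K z eq by (simp add: abs_mult)
    also have "\<dots> \<le> r ^ length ls * (2 * K)"
      using prod abs_jump_series_le[OF l lip] z r by (intro mult_mono) auto
    finally show "length ls < M"
      using M[of "length ls"] by linarith
  qed
qed

section \<open>Multiplicities and maximal factorizations\<close>

text \<open>For witnesses \<open>n < n'\<close>, cancelling \<open>n\<close> factors shows that the
  function belonging to \<open>n\<close> is some \<open>Lop l lam \<rho>\<close> plus a constant.
  Minus its mean it is still in the range, contrary to \<open>mult_zero\<close>.\<close>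

lemma mult_witness_unique:
  assumes l: "l \<ge> 2" and lam: "0 < lam" "lam \<le> 1"
    and n: "mult_witness l \<tau> lam n" and n': "mult_witness l \<tau> lam n'"
  shows "n = n'"
proof -
  have no: False
    if n: "mult_witness l \<tau> lam n" and n': "mult_witness l \<tau> lam n'" and "n < n'" for n n'
  proof -
    obtain \<mu> where \<mu>: "circle_continuous \<mu>" "(Lop l lam ^^ n) \<mu> = \<tau>"
      and mz: "mult_zero l (\<lambda>x. \<mu> x - circle_integral \<mu>) lam"
      using n by (auto simp: mult_witness_def)
    obtain \<mu>' where \<mu>': "circle_continuous \<mu>'" "(Lop l lam ^^ n') \<mu>' = \<tau>"
      using n' by (auto simp: mult_witness_def)
    \<comment> \<open>One of the \<open>n' - n\<close> surplus factors is held back, to be the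
      \<open>Lop l lam\<close> applied to \<open>\<rho>\<close>.\<close>
    define \<rho> where "\<rho> = (Lop l lam ^^ (n' - n - 1)) \<mu>'"
    have \<rho>: "circle_continuous \<rho>"
      unfolding \<rho>_def by (intro circle_continuous_Lop_funpow \<mu>')
    have "Lop l lam \<rho> = (Lop l lam ^^ Suc (n' - n - 1)) \<mu>'"
      by (simp add: \<rho>_def)
    also have "Suc (n' - n - 1) = n' - n"
      using \<open>n < n'\<close> by simp
    finally have "(Lop l lam ^^ n) (Lop l lam \<rho>) = \<tau>"
      using \<mu>'(2) \<open>n < n'\<close> by (simp flip: o_apply[of "Lop l lam ^^ n"] funpow_add)
    then obtain c where c: "\<mu> = (\<lambda>x. Lop l lam \<rho> x + c)"
      using Lop_funpow_eq_imp_diff_const[OF l lam \<mu>(1) circle_continuous_Lop[OF \<rho>], of n] \<mu>(2) by auto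
    have "circle_integral \<mu> = (1 - lam) * circle_integral \<rho> + c"
      unfolding c using l
      by (simp add: circle_integral_add_const circle_continuous_Lop \<rho> circle_integral_Lop)
    \<comment> \<open>Centering \<open>\<rho>\<close> subtracts
      \<open>(1 - lam) * circle_integral \<rho>\<close>, exactly the mean of
      \<open>Lop l lam \<rho>\<close>, also for \<open>lam = 1\<close>.\<close>
    then have "(\<lambda>x. \<mu> x - circle_integral \<mu>) = Lop l lam (\<lambda>x. \<rho> x + (- circle_integral \<rho>))"
      unfolding Lop_add_const by (simp add: c fun_eq_iff)
    with mz circle_continuous_add_const[OF \<rho>] show False
      unfolding mult_zero_def by metis
  qed
  show ?thesis
    using no[OF n n'] no[OF n' n] by (metis nat_neq_iff)
qed

lemma Lmult_eqI:
  assumes "l \<ge> 2" "0 < lam" "lam \<le> 1" "mult_witness l \<tau> lam n" "\<not> mult_zero l \<tau> lam"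
  shows "Lmult l \<tau> lam = enat n"
proof -
  have "(THE n. mult_witness l \<tau> lam n) = n"
    using assms mult_witness_unique by (intro the_equality) blast+
  then show ?thesis
    using assms by (auto simp: Lmult_def)
qed

text \<open>Distinct factors are coprime: \<open>Lop l a\<close> and \<open>Lop l lam\<close> differ by a nonzero multiple of
  the identity.\<close>

lemma Lop_comp_range_cancel:
  assumes "lam \<notin> set ls" "circle_continuous \<mu>" "circle_continuous \<nu>"
    and "Lop_comp l ls \<mu> = (\<lambda>x. Lop l lam \<nu> x + c)"
  shows "\<exists>\<rho> d. circle_continuous \<rho> \<and> \<mu> = (\<lambda>x. Lop l lam \<rho> x + d) \<and> (c = 0 \<longrightarrow> d = 0)"
  using assms
proof (induction ls arbitrary: \<nu> c)
  case (Cons a ls)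
  define \<sigma> where "\<sigma> = Lop_comp l ls \<mu>"
  have \<sigma>: "circle_continuous \<sigma>"
    unfolding \<sigma>_def by (intro circle_continuous_Lop_comp Cons.prems)
  have ne: "lam - a \<noteq> 0"
    using Cons.prems(1) by auto
  \<comment> \<open>Obtained by solving \<open>Lop l lam \<sigma> + (lam - a) * \<sigma> = Lop l lam
    \<nu> + c\<close> for \<open>\<sigma>\<close>; the left side is
    \<open>Lop l a \<sigma>\<close>.\<close>
  define \<rho> where "\<rho> = (\<lambda>x. (1 / (lam - a)) * \<nu> x + (- 1 / (lam - a)) * \<sigma> x)"
  have \<rho>: "circle_continuous \<rho>"
    unfolding \<rho>_def by (intro circle_continuous_linear \<sigma> Cons.prems)
  have "\<sigma> x = Lop l lam \<rho> x + c / (lam - a)" for x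
  proof -
    have "Lop l a \<sigma> x = Lop l lam \<nu> x + c"
      using fun_cong[OF Cons.prems(4), of x] by (simp add: \<sigma>_def)
    then have "(lam - a) * \<sigma> x = Lop l lam \<nu> x - Lop l lam \<sigma> x + c"
      by (simp add: Lop_apply algebra_simps)
    with ne have "\<sigma> x = (Lop l lam \<nu> x - Lop l lam \<sigma> x + c) / (lam - a)"
      by (simp add: eq_divide_eq mult.commute)
    then show ?thesis
      unfolding \<rho>_def Lop_linear by (simp add: diff_divide_distrib add_divide_distrib)
  qed
  then have "Lop_comp l ls \<mu> = (\<lambda>x. Lop l lam \<rho> x + c / (lam - a))"
    by (simp add: \<sigma>_def fun_eq_iff)
  from Cons.IH[OF _ Cons.prems(2) \<rho> this] Cons.prems(1) ne show ?case
    by auto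
qed auto

text \<open>For \<open>lam \<noteq> 1\<close> the constant comes from shifting
  \<open>\<rho>\<close>; for \<open>lam = 1\<close> it is 0 or annihilated by a factor 1 in
  \<open>ls\<close>.\<close>

lemma Lop_comp_add_const_absorb:
  assumes ls: "\<And>a. a \<in> set ls \<Longrightarrow> a \<le> 1" and \<rho>: "circle_continuous \<rho>"
    and d: "d = 0 \<or> lam \<noteq> 1 \<or> 1 \<in> set ls"
  shows "\<exists>\<rho>'. circle_continuous \<rho>' \<and>
    Lop_comp l ls (\<lambda>x. Lop l lam \<rho> x + d) = Lop_comp l (lam # ls) \<rho>'"
proof (cases "lam = 1")
  case False
  then have "Lop l lam (\<lambda>x. \<rho> x + d / (1 - lam)) = (\<lambda>x. Lop l lam \<rho> x + d)"
    by (simp add: Lop_add_const)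
  then show ?thesis
    by (intro exI[of _ "\<lambda>x. \<rho> x + d / (1 - lam)"] conjI circle_continuous_add_const[OF \<rho>])
      (simp flip: Lop_comp_commute)
next
  case True
  then have "(\<Prod>a\<leftarrow>ls. 1 - a) * d = 0"
    using d by (auto intro: prod_list_eq_0_if_mem)
  then show ?thesis
    using \<rho> unfolding Lop_comp_add_const
    by (intro exI[of _ \<rho>]) (simp only: Lop_comp_commute Lop_comp_Cons add_0_right simp_thms)
qed

text \<open>The competitors end in merely continuous functions, as in the definition of the
  multiplicity.\<close>

definition maximal_factorization :: "nat \<Rightarrow> (real \<Rightarrow> real) \<Rightarrow> real list \<Rightarrow> bool" where
  "maximal_factorization l \<tau> ls \<longleftrightarrow> set ls \<subseteq> {0<..1} \<and>
     (\<exists>\<mu>. circle_continuous \<mu> \<and> \<tau> = Lop_comp l ls \<mu>) \<and>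
     (\<forall>ls' \<rho>. set ls' \<subseteq> {0<..1} \<and> circle_continuous \<rho> \<and> \<tau> = Lop_comp l ls' \<rho> \<longrightarrow>
        length ls' \<le> length ls)"

lemma exists_maximal_factorization:
  assumes "l \<ge> 2" "circle_lipschitz \<tau>" "\<not> \<tau> constant_on UNIV"
  obtains ls where "maximal_factorization l \<tau> ls"
proof -
  define P where "P ls \<longleftrightarrow> set ls \<subseteq> {0<..1} \<and> (\<exists>\<mu>. circle_continuous \<mu> \<and> \<tau> = Lop_comp l ls \<mu>)" for ls
  obtain M where "\<And>ls \<mu>. set ls \<subseteq> {0<..1} \<Longrightarrow> circle_continuous \<mu> \<Longrightarrow> \<tau> = Lop_comp l ls \<mu> \<Longrightarrow>
      length ls < M"
    using length_factorization_bounded[OF assms] by blast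
  then have M: "\<forall>ls. P ls \<longrightarrow> length ls < M"
    by (auto simp: P_def)
  have "P []"
    using assms(2) by (auto simp: P_def intro: circle_lipschitz_imp_continuous)
  from Lattices_Big.ex_has_greatest_nat[of P, OF this M]
  obtain ls where "P ls" "\<forall>ls'. P ls' \<longrightarrow> length ls' \<le> length ls"
    by blast
  then show ?thesis
    by (intro that[of ls]) (auto simp: maximal_factorization_def P_def)
qed

lemma maximal_factorization_not_range:
  assumes "maximal_factorization l \<tau> ls" "\<tau> = Lop_comp l ls \<mu>" "0 < lam" "lam \<le> 1"
    and "circle_continuous \<rho>" and "d = 0 \<or> lam \<noteq> 1 \<or> 1 \<in> set ls"
  shows "\<mu> \<noteq> (\<lambda>x. Lop l lam \<rho> x + d)"
proof
  assume "\<mu> = (\<lambda>x. Lop l lam \<rho> x + d)"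
  moreover have "\<And>a. a \<in> set ls \<Longrightarrow> a \<le> 1"
    using assms(1) by (auto simp: maximal_factorization_def)
  ultimately obtain \<rho>' where "circle_continuous \<rho>'" "\<tau> = Lop_comp l (lam # ls) \<rho>'"
    using Lop_comp_add_const_absorb[OF _ assms(5,6), of l] assms(2) by auto
  moreover have "set (lam # ls) \<subseteq> {0<..1}"
    using assms by (auto simp: maximal_factorization_def)
  ultimately have "length (lam # ls) \<le> length ls"
    using assms(1) unfolding maximal_factorization_def by blast
  then show False by simp
qed

text \<open>Pull out the \<open>k\<close> factors \<open>lam\<close>, leaving
  \<open>\<sigma>\<close>. If \<open>\<sigma>\<close> had a further factor \<open>lam\<close>,
  coprimality would pass it on to \<open>\<mu>\<close>, contrary to maximality.\<close>

lemma Lmult_maximal_factorization: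
  assumes l: "l \<ge> 2" and max: "maximal_factorization l \<tau> ls" and lam: "0 < lam" "lam \<le> 1"
  shows "Lmult l \<tau> lam = enat (count_list ls lam)"
proof -
  obtain \<mu> where \<mu>: "circle_continuous \<mu>" and \<tau>: "\<tau> = Lop_comp l ls \<mu>"
    using max by (auto simp: maximal_factorization_def)
  define \<sigma> where "\<sigma> = Lop_comp l (filter (\<lambda>a. a \<noteq> lam) ls) \<mu>"
  define k where "k = count_list ls lam"
  have \<sigma>: "circle_continuous \<sigma>"
    unfolding \<sigma>_def by (intro circle_continuous_Lop_comp \<mu>)
  have \<tau>_eq: "\<tau> = (Lop l lam ^^ k) \<sigma>"
    unfolding \<tau> \<sigma>_def k_def by (rule Lop_comp_split)
  \<comment> \<open>A nonzero \<open>c\<close> is allowed only if \<open>lam\<close> occurs in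
    \<open>ls\<close>: for \<open>lam = 1\<close> that factor annihilates the constant. The case
    \<open>k = 0\<close> uses \<open>c = 0\<close>, the other one the mean of
    \<open>\<sigma>\<close>.\<close>
  have no: "\<sigma> \<noteq> (\<lambda>x. Lop l lam \<nu> x + c)" if \<nu>: "circle_continuous \<nu>" and c: "c = 0 \<or> k > 0" for \<nu> c
  proof
    assume "\<sigma> = (\<lambda>x. Lop l lam \<nu> x + c)"
    then obtain \<rho> d where "circle_continuous \<rho>" "\<mu> = (\<lambda>x. Lop l lam \<rho> x + d)" and d: "c = 0 \<longrightarrow> d = 0"
      using Lop_comp_range_cancel[OF _ \<mu> \<nu>, of lam "filter (\<lambda>a. a \<noteq> lam) ls" l c] by (auto simp: \<sigma>_def)
    moreover have "lam \<in> set ls" if "k > 0"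
      using that by (metis count_list_0_iff k_def less_irrefl)
    ultimately show False
      using maximal_factorization_not_range[OF max \<tau> lam, of \<rho> d] c by blast
  qed
  show ?thesis
  proof (cases "k = 0")
    case True
    then have "mult_zero l \<tau> lam"
      using no[of _ 0] \<tau>_eq by (auto simp: mult_zero_def)
    then show ?thesis
      using True by (simp add: Lmult_def k_def zero_enat_def)
  next
    case False
    then obtain m where m: "k = Suc m"
      by (cases k) auto
    have "mult_zero l (\<lambda>x. \<sigma> x - circle_integral \<sigma>) lam"
      unfolding mult_zero_def
    proof (intro allI impI notI)
      fix \<nu>
      assume "circle_continuous \<nu>" and eq: "Lop l lam \<nu> = (\<lambda>x. \<sigma> x - circle_integral \<sigma>)"
      moreover have "\<sigma> = (\<lambda>x. Lop l lam \<nu> x + circle_integral \<sigma>)"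
        by (simp add: eq)
      ultimately show False
        using no False by blast
    qed
    then have "mult_witness l \<tau> lam k"
      using \<sigma> \<tau>_eq False by (auto simp: mult_witness_def)
    moreover have "\<not> mult_zero l \<tau> lam"
      using \<tau>_eq m circle_continuous_Lop_funpow[OF \<sigma>] by (auto simp: mult_zero_def)
    ultimately show ?thesis
      using Lmult_eqI[OF l lam] by (simp add: k_def)
  qed
qed

theorem lemma5p9:
  fixes l :: nat and \<tau> :: "real \<Rightarrow> real"
  assumes "l \<ge> 2" and "circle_lipschitz \<tau>" and "\<not> \<tau> constant_on UNIV"
  shows "finite (J' l \<tau>) \<and> (\<forall>lam\<in>J' l \<tau>. Lmult l \<tau> lam \<noteq> \<infinity>) \<and>
    (\<forall>lams. enumerates_J' l \<tau> lams \<longrightarrow>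
      (\<exists>\<mu>. circle_lipschitz \<mu> \<and> \<tau> = Lop_comp l lams \<mu> \<and> lipschitz_irreducible l \<mu>) \<and>
      (circle_integral \<tau> = 0 \<longrightarrow>
        (\<exists>\<mu>. circle_lipschitz \<mu> \<and> \<tau> = Lop_comp l lams \<mu> \<and> lipschitz_irreducible l \<mu> \<and>
             circle_integral \<mu> = 0)))"
proof -
  obtain ls where max: "maximal_factorization l \<tau> ls"
    by (rule exists_maximal_factorization[OF assms])
  then have ls: "set ls \<subseteq> {0<..1}"
    by (simp add: maximal_factorization_def)
  obtain \<mu> where \<mu>: "circle_continuous \<mu>" and \<tau>: "\<tau> = Lop_comp l ls \<mu>"
    using max by (auto simp: maximal_factorization_def)
  have Lmult: "Lmult l \<tau> lam = enat (count_list ls lam)" if "lam \<in> {0<..1}" for lam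
    using Lmult_maximal_factorization[OF assms(1) max] that by auto
  have "lam \<in> J' l \<tau> \<longleftrightarrow> lam \<in> set ls" for lam
    using ls Lmult[of lam] count_list_0_iff[of ls lam]
    by (cases "lam \<in> {0<..1}") (auto simp: J'_def zero_enat_def)
  then have J': "J' l \<tau> = set ls"
    by blast
  obtain K where K: "K-lipschitz_on UNIV \<tau>"
    using assms(2) by (auto simp: circle_lipschitz_def)
  \<comment> \<open>Stated for every continuous \<open>\<nu>\<close>, so that the mean can be
    corrected without losing these properties.\<close>
  have good: "circle_lipschitz \<nu> \<and> lipschitz_irreducible l \<nu>"
    if \<nu>: "circle_continuous \<nu>" and eq: "\<tau> = Lop_comp l ls \<nu>" for \<nu>
  proof -
    have "K-lipschitz_on UNIV \<nu>"
      using lipschitz_on_Lop_comp_preimage[OF assms(1) ls \<nu>] K eq by simp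
    then have "circle_lipschitz \<nu>"
      using \<nu> by (auto simp: circle_lipschitz_def circle_continuous_def)
    moreover have "\<nu> \<noteq> Lop l lam \<rho>" if "circle_lipschitz \<rho>" "0 < lam" "lam \<le> 1" for \<rho> lam
      using maximal_factorization_not_range[OF max eq that(2,3)
          circle_lipschitz_imp_continuous[OF that(1)], of 0] by simp
    ultimately show ?thesis
      by (auto simp: lipschitz_irreducible_def)
  qed
  \<comment> \<open>If 1 occurs in \<open>ls\<close>, constants are annihilated and the mean of
    \<open>\<mu>\<close> can be subtracted. Otherwise the mean of \<open>\<tau>\<close> is a nonzero
    multiple of that of \<open>\<mu>\<close>.\<close>
  have mean0: "\<exists>\<nu>. circle_continuous \<nu> \<and> \<tau> = Lop_comp l ls \<nu> \<and> circle_integral \<nu> = 0"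
    if mean: "circle_integral \<tau> = 0"
  proof (cases "1 \<in> set ls")
    case True
    then have "(\<Prod>a\<leftarrow>ls. 1 - a) = 0"
      by (rule prod_list_eq_0_if_mem) simp
    then show ?thesis
      using \<mu> \<tau> circle_integral_add_const[OF \<mu>, of "- circle_integral \<mu>"]
        circle_continuous_add_const[OF \<mu>, of "- circle_integral \<mu>"]
      by (intro exI[of _ "\<lambda>x. \<mu> x + - circle_integral \<mu>"]) (simp only: Lop_comp_add_const, simp)
  next
    case False
    then have "(\<Prod>a\<leftarrow>ls. 1 - a) \<noteq> 0"
      by (auto simp: prod_list_zero_iff)
    then show ?thesis
      using mean \<mu> \<tau> circle_integral_Lop_comp[OF \<mu>, of l ls] assms(1) by auto
  qed
  \<comment> \<open>Both lists repeat each element according to its multiplicity, so they are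
    permutations of each other.\<close>
  have comp_eq: "Lop_comp l lams = Lop_comp l ls" if "enumerates_J' l \<tau> lams" for lams
  proof (rule Lop_comp_mset_cong, rule multiset_eqI)
    fix a
    have "count_list lams a = count_list ls a"
    proof (cases "a \<in> set ls")
      case True
      then have "enat (count_list lams a) = enat (count_list ls a)"
        using that ls Lmult[of a] J' unfolding enumerates_J'_def by (metis subsetD)
      then show ?thesis
        by simp
    next
      case False
      then show ?thesis
        using that by (metis count_notin enumerates_J'_def J')
    qed
    then show "count (mset lams) a = count (mset ls) a"
      by (simp add: count_mset)
  qed
  show ?thesis
  proof (intro conjI allI impI ballI)
    show "finite (J' l \<tau>)"
      by (simp add: J')
    show "Lmult l \<tau> lam \<noteq> \<infinity>" if "lam \<in> J' l \<tau>" for lam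
      using that Lmult[of lam] ls by (auto simp: J')
    fix lams
    assume "enumerates_J' l \<tau> lams"
    then have eq: "Lop_comp l lams = Lop_comp l ls"
      by (rule comp_eq)
    show "\<exists>\<mu>. circle_lipschitz \<mu> \<and> \<tau> = Lop_comp l lams \<mu> \<and> lipschitz_irreducible l \<mu>"
      unfolding eq using good[OF \<mu> \<tau>] \<tau> by (intro exI[of _ \<mu>] conjI) simp_all
    assume "circle_integral \<tau> = 0"
    then obtain \<nu> where \<nu>: "circle_continuous \<nu>" "\<tau> = Lop_comp l ls \<nu>" "circle_integral \<nu> = 0"
      using mean0 by blast
    show "\<exists>\<mu>. circle_lipschitz \<mu> \<and> \<tau> = Lop_comp l lams \<mu> \<and> lipschitz_irreducible l \<mu> \<and>
        circle_integral \<mu> = 0"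
      unfolding eq using good[OF \<nu>(1,2)] \<nu>(2,3) by (intro exI[of _ \<nu>] conjI) simp_all
  qed
qed

end
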